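(* Let $G$ be a subgroup of $Gl(n,\mathbb{R})$ which acts irreducibly on $\mathbb{R}^n$. Then the space of $G$-invariant symmetric bilinear forms on $\mathbb{R}^n$ which are not of neutral signature is at most one-dimensional, i.e. any two $G$-invariant symmetric bilinear forms on $\mathbb{R}^n$, neither of which has neutral signature $(p,p)$, are linearly dependent. Moreover, the real vector space of all $G$-invariant symmetric bilinear forms on $\mathbb{R}^n$ is at most three-dimensional.
   Context: A bilinear form $b$ on $\mathbb{R}^n$ is $G$-invariant if $b(gx,gy)=b(x,y)$ for all $g\in G$ and $x,y\in\mathbb{R}^n$. A symmetric bilinear form has neutral signature $(p,p)$ if it is non-degenerate, $n=2p$, and it has $p$ negative and $p$ positive directions. "Acts irreducibly" means that the only $G$-invariant real linear subspaces are $\{0\}$ and $\mathbb{R}^n$. *)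

theory Defs
  imports
    "HOL-Analysis.Analysis"
    "HOL-Algebra.Group"
    "HOL-Library.Function_Algebras"
begin

definition GL :: "(real^'n^'n) monoid"
  where "GL = \<lparr>carrier = {A. invertible A}, monoid.mult = (**), one = mat 1\<rparr>"

lemma group_GL: "group (GL :: (real^'n^'n) monoid)"
proof (rule groupI)
  fix A :: "real^'n^'n"
  assume "A \<in> carrier GL"
  then obtain B where "A ** B = mat 1" "B ** A = mat 1"
    by (auto simp: GL_def invertible_def)
  then show "\<exists>B\<in>carrier GL. B \<otimes>\<^bsub>GL\<^esub> A = \<one>\<^bsub>GL\<^esub>"
    by (auto simp: GL_def invertible_def)
qed (auto simp: GL_def invertible_mult matrix_mul_assoc invertible_def[of "mat 1"])

definition acts_irreducibly :: "(real^'n^'n) set \<Rightarrow> bool"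
  where "acts_irreducibly G \<longleftrightarrow>
    (\<forall>U. subspace U \<and> (\<forall>g\<in>G. \<forall>x\<in>U. g *v x \<in> U) \<longrightarrow> U = {0} \<or> U = UNIV)"

definition symmetric_form :: "('a \<Rightarrow> 'a \<Rightarrow> real) \<Rightarrow> bool"
  where "symmetric_form b \<longleftrightarrow> (\<forall>x y. b x y = b y x)"

definition invariant_form :: "(real^'n^'n) set \<Rightarrow> (real^'n \<Rightarrow> real^'n \<Rightarrow> real) \<Rightarrow> bool"
  where "invariant_form G b \<longleftrightarrow> (\<forall>g\<in>G. \<forall>x y. b (g *v x) (g *v y) = b x y)"

definition invariant_symmetric_forms :: "(real^'n^'n) set \<Rightarrow> (real^'n \<Rightarrow> real^'n \<Rightarrow> real) set"
  where "invariant_symmetric_forms G = {b. bilinear b \<and> symmetric_form b \<and> invariant_form G b}"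

definition nondegenerate_form :: "('a::zero \<Rightarrow> 'a \<Rightarrow> real) \<Rightarrow> bool"
  where "nondegenerate_form b \<longleftrightarrow> (\<forall>x. (\<forall>y. b x y = 0) \<longrightarrow> x = 0)"

text \<open>
  The numbers of positive and negative directions of a symmetric bilinear form, as the
  largest dimensions of subspaces on which it is positive or negative definite.
\<close>

definition positive_index :: "(real^'n \<Rightarrow> real^'n \<Rightarrow> real) \<Rightarrow> nat"
  where "positive_index b = Max {dim U |U. subspace U \<and> (\<forall>x\<in>U. x \<noteq> 0 \<longrightarrow> b x x > 0)}"

definition negative_index :: "(real^'n \<Rightarrow> real^'n \<Rightarrow> real) \<Rightarrow> nat"
  where "negative_index b = Max {dim U |U. subspace U \<and> (\<forall>x\<in>U. x \<noteq> 0 \<longrightarrow> b x x < 0)}"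

definition neutral_signature :: "(real^'n \<Rightarrow> real^'n \<Rightarrow> real) \<Rightarrow> bool"
  where "neutral_signature b \<longleftrightarrow> nondegenerate_form b \<and>
    (\<exists>p. CARD('n) = 2 * p \<and> negative_index b = p \<and> positive_index b = p)"

text \<open>
  The function type is not an instance of \<^class>\<open>real_vector\<close>, so the pointwise
  real vector space structure on forms is supplied by an interpretation.
\<close>

definition scale_form :: "real \<Rightarrow> ('a \<Rightarrow> 'a \<Rightarrow> real) \<Rightarrow> 'a \<Rightarrow> 'a \<Rightarrow> real"
  where "scale_form c b = (\<lambda>x y. c * b x y)"

global_interpretation form: vector_space scale_form
  by standard (auto simp: scale_form_def fun_eq_iff algebra_simps)

lemma subspace_invariant_symmetric_forms: "form.subspace (invariant_symmetric_forms G)"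
  by (auto simp: form.subspace_def invariant_symmetric_forms_def bilinear_def linear_iff
      symmetric_form_def invariant_form_def scale_form_def algebra_simps)

end

theory Submission
  imports Defs "HOL-Computational_Algebra.Fundamental_Theorem_Algebra"
begin

text \<open>
  A nonzero invariant symmetric form \<open>b\<close> is nondegenerate, because its radical is an invariant
  subspace. It therefore identifies every other invariant symmetric form with an operator \<open>f\<close>,
  by \<open>b' x y = b (f x) y\<close>; this \<open>f\<close> commutes with \<open>G\<close> and is self-adjoint for \<open>b\<close>
  (\<open>form_represented_by_intertwiner\<close>). Everything thus takes place in the algebra of operators
  commuting with \<open>G\<close>. By Schur's lemma it is a division algebra, and since every real operator
  has an invariant subspace of dimension at most two, each of its elements is a scalar or has the
  form \<open>a + c J\<close> with \<open>J\<^sup>2 = -1\<close> and \<open>c \<noteq> 0\<close>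
  (\<open>intertwiner_scalar_or_complex_structure\<close>).

  If \<open>b'\<close> is not a multiple of \<open>b\<close>, then its operator yields a self-adjoint \<open>J\<close> with \<open>J\<^sup>2 = -1\<close>,
  and \<open>b (J x) (J x) = b (J (J x)) x = - b x x\<close>. Hence \<open>J\<close> interchanges positive and negative
  directions and \<open>b\<close> is neutral. This gives the first claim.

  For the dimension bound fix such a \<open>J\<close>. Every self-adjoint \<open>f\<close> splits into a part commuting
  with \<open>J\<close> and a part anticommuting with \<open>J\<close>, both self-adjoint. The commuting part lies in the
  span of \<open>1\<close> and \<open>J\<close>, because the complex numbers are their own centralizer in a division
  algebra of this kind (\<open>intertwiner_commuting_with_complex_structure\<close>). The anticommuting
  parts are all proportional (\<open>anticommuting_selfadjoint_proportional\<close>): in quaternionic terms, if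
  the anticommuting units \<open>i\<close> and \<open>j\<close> are self-adjoint, then \<open>ij\<close> is skew. So three operators span.
\<close>

section \<open>Invariant planes of real operators\<close>

definition operator_poly :: "('a \<Rightarrow> 'a) \<Rightarrow> real poly \<Rightarrow> 'a \<Rightarrow> 'a::real_vector"
  where "operator_poly f p = fold_coeffs (\<lambda>a h x. a *\<^sub>R x + f (h x)) p (\<lambda>_. 0)"

lemma operator_poly_0 [simp]: "operator_poly f 0 x = 0"
  by (simp add: operator_poly_def)

lemma operator_poly_pCons [simp]:
  assumes "linear f"
  shows "operator_poly f (pCons a p) x = a *\<^sub>R x + f (operator_poly f p x)"
proof (cases "a = 0 \<and> p = 0")
  case True
  then show ?thesis by (simp add: linear_0[OF assms])
next
  case False
  then show ?thesis by (auto simp: operator_poly_def)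
qed

lemma operator_poly_add:
  assumes "linear f"
  shows "operator_poly f (p + q) x = operator_poly f p x + operator_poly f q x"
  by (induction p q rule: poly_induct2)
    (simp_all add: assms linear_add[OF assms] algebra_simps)

lemma operator_poly_smult:
  assumes "linear f"
  shows "operator_poly f (smult c p) x = c *\<^sub>R operator_poly f p x"
  by (induction p) (simp_all add: assms linear_scale[OF assms] algebra_simps)

lemma operator_poly_mult:
  assumes "linear f"
  shows "operator_poly f (p * q) x = operator_poly f p (operator_poly f q x)"
  by (induction p) (simp_all add: assms operator_poly_add operator_poly_smult)

lemma operator_poly_monom:
  assumes "linear f"
  shows "operator_poly f (monom c n) x = c *\<^sub>R (f ^^ n) x"
  by (induction n) (simp_all add: assms linear_scale[OF assms] linear_0[OF assms] monom_0 monom_Suc)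

lemma operator_poly_sum:
  assumes "linear f"
  shows "operator_poly f (\<Sum>i\<in>I. p i) x = (\<Sum>i\<in>I. operator_poly f (p i) x)"
  by (induction I rule: infinite_finite_induct) (simp_all add: operator_poly_add[OF assms])

text \<open>The iterates \<open>x, f x, f (f x), \<dots>\<close> cannot all be independent.\<close>

lemma vector_annihilated_by_operator_poly:
  fixes f :: "'a::euclidean_space \<Rightarrow> 'a"
  assumes "linear f"
  shows "\<exists>p. p \<noteq> 0 \<and> operator_poly f p x = 0"
proof (cases "inj_on (\<lambda>i. (f ^^ i) x) {..DIM('a)}")
  case True
  let ?v = "\<lambda>i. (f ^^ i) x"
  have "card (?v ` {..DIM('a)}) = Suc DIM('a)"
    by (simp add: card_image[OF True])
  then have "dependent (?v ` {..DIM('a)})"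
    using independent_bound[of "?v ` {..DIM('a)}"] by auto
  then obtain u where u: "\<exists>v\<in>?v ` {..DIM('a)}. u v \<noteq> 0"
    and sum0: "(\<Sum>v\<in>?v ` {..DIM('a)}. u v *\<^sub>R v) = 0"
    by (auto simp: dependent_finite)
  define p where "p = (\<Sum>i\<le>DIM('a). monom (u (?v i)) i)"
  from u obtain j where "j \<le> DIM('a)" "u (?v j) \<noteq> 0"
    by auto
  then have "coeff p j \<noteq> 0"
    by (simp add: p_def coeff_sum)
  then have "p \<noteq> 0"
    by auto
  moreover have "operator_poly f p x = 0"
    using sum0 by (simp add: p_def operator_poly_sum operator_poly_monom assms sum.reindex[OF True])
  ultimately show ?thesis
    by blast
next
  case False
  then obtain i j where ij: "i \<noteq> j" "(f ^^ i) x = (f ^^ j) x"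
    by (auto simp: inj_on_def)
  have "coeff (monom 1 i + monom (-1) j) i \<noteq> (0::real)"
    using ij by simp
  then have "monom 1 i + monom (-1) j \<noteq> (0::real poly)"
    by (metis coeff_0)
  then show ?thesis
    using ij by (intro exI[of _ "monom 1 i + monom (-1) j"])
      (simp add: operator_poly_add operator_poly_monom assms)
qed

text \<open>
  With \<open>z = a + i c\<close> a complex root, the factor is the minimal polynomial of \<open>z\<close> over the reals.
\<close>

lemma real_poly_has_linear_or_quadratic_factor:
  fixes p :: "real poly"
  assumes "degree p > 0"
  shows "\<exists>a c. [:-a, 1:] dvd p \<or> [:a\<^sup>2 + c\<^sup>2, -2 * a, 1:] dvd p"
proof -
  let ?C = "map_poly complex_of_real"
  have add: "?C (q + r) = ?C q + ?C r" for q r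
    by (simp add: poly_eq_iff coeff_map_poly)
  have mult: "?C (q * r) = ?C q * ?C r" for q r
    by (simp add: poly_eq_iff coeff_map_poly coeff_mult)
  have "degree (?C p) > 0"
    using assms by (simp add: degree_map_poly)
  then obtain z where z: "poly (?C p) z = 0"
    using alg_closed_imp_poly_has_root by blast
  define a c where "a = Re z" and "c = Im z"
  have z_eq: "z = Complex a c"
    by (simp add: a_def c_def)
  show ?thesis
  proof (cases "c = 0")
    case True
    then have "z = of_real a"
      by (simp add: z_eq complex_eq_iff)
    moreover have "poly (?C q) (of_real a) = of_real (poly q a)" for q
      by (induction q) (simp_all add: map_poly_pCons)
    ultimately have "poly p a = 0"
      using z by simp
    then show ?thesis
      by (auto simp: poly_eq_0_iff_dvd)
  next
    case False
    define m where "m = [:a\<^sup>2 + c\<^sup>2, -2 * a, 1:]"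
    define r where "r = p mod m"
    have root_m: "poly (?C m) z = 0"
      by (simp add: m_def z_eq map_poly_pCons complex_eq_iff power2_eq_square algebra_simps)
    have "p = p div m * m + r"
      by (simp add: r_def)
    then have "poly (?C p) z = poly (?C (p div m)) z * poly (?C m) z + poly (?C r) z"
      by (metis add mult poly_add poly_mult)
    then have root_r: "poly (?C r) z = 0"
      using z root_m by simp
    have "m \<noteq> 0" "degree m = 2"
      by (simp_all add: m_def)
    then have "degree r < 2"
      using degree_mod_less[of m p] by (auto simp: r_def)
    obtain r0 s where s: "r = pCons r0 s"
      by (rule pCons_cases)
    with \<open>degree r < 2\<close> have "degree s = 0"
      by (simp add: degree_pCons_eq_if split: if_splits)
    then obtain r1 where r: "r = [:r0, r1:]"
      using s degree_eq_zeroE by metis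
    have "r1 * c = 0 \<and> r0 + r1 * a = 0"
      using root_r by (simp add: r z_eq map_poly_pCons complex_eq_iff algebra_simps)
    then have "r = 0"
      using False by (auto simp: r)
    then have "m dvd p"
      by (simp add: r_def mod_eq_0_iff_dvd)
    then show ?thesis
      unfolding m_def by blast
  qed
qed

text \<open>
  Split off real factors of an annihilating polynomial until one of them kills a nonzero vector
  \<open>x\<close>; then \<open>x\<close> and \<open>f x\<close> span an invariant subspace of dimension one or two. The shape of the
  coefficients makes the discriminant nonpositive, so that completing the square gives
  \<open>(f - a)\<^sup>2 = - c\<^sup>2\<close> at \<open>x\<close>.
\<close>

lemma operator_annihilated_by_quadratic:
  fixes f :: "'a::euclidean_space \<Rightarrow> 'a"
  assumes lin: "linear f"
  shows "\<exists>a c x. x \<noteq> 0 \<and> f (f x) = (2 * a) *\<^sub>R f x - (a\<^sup>2 + c\<^sup>2) *\<^sub>R x"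
proof -
  have descent: "\<exists>a c y. y \<noteq> 0 \<and> f (f y) = (2 * a) *\<^sub>R f y - (a\<^sup>2 + c\<^sup>2) *\<^sub>R y"
    if "p \<noteq> 0" "x \<noteq> 0" "operator_poly f p x = 0" for p x
    using that
  proof (induction "degree p" arbitrary: p x rule: less_induct)
    case less
    show ?case
    proof (cases "degree p = 0")
      case True
      then obtain k where "p = [:k:]"
        by (rule degree_eq_zeroE)
      then show ?thesis
        using less.prems by (simp add: lin linear_0[OF lin])
    next
      case False
      then obtain a c m where m: "m dvd p" "m = [:-a, 1:] \<or> m = [:a\<^sup>2 + c\<^sup>2, -2 * a, 1:]"
        using real_poly_has_linear_or_quadratic_factor by blast
      from m(1) obtain q where q: "p = q * m"
        by (metis dvdE mult.commute)
      have kernel: "operator_poly f q (operator_poly f m x) = 0"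
        using less.prems by (simp add: q operator_poly_mult lin)
      have "degree m > 0" "q \<noteq> 0" "m \<noteq> 0"
        using m(2) less.prems(1) q by auto
      then have "degree q < degree p"
        by (simp add: q degree_mult_eq)
      show ?thesis
      proof (cases "operator_poly f m x = 0")
        case True
        from m(2) show ?thesis
        proof
          assume "m = [:-a, 1:]"
          then have "f x = a *\<^sub>R x"
            using True by (simp add: lin linear_0[OF lin])
          then have "f (f x) = (2 * a) *\<^sub>R f x - (a\<^sup>2 + 0\<^sup>2) *\<^sub>R x"
            by (simp add: linear_scale[OF lin] power2_eq_square flip: scaleR_diff_left)
          then show ?thesis
            using less.prems(2) by blast
        next
          assume "m = [:a\<^sup>2 + c\<^sup>2, -2 * a, 1:]"
          then have "(a\<^sup>2 + c\<^sup>2) *\<^sub>R x + (f (f x) - (2 * a) *\<^sub>R f x) = 0"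
            using True
            by (simp add: lin linear_0[OF lin] linear_add[OF lin] linear_scale[OF lin]
                linear_diff[OF lin])
          then have "f (f x) = (2 * a) *\<^sub>R f x - (a\<^sup>2 + c\<^sup>2) *\<^sub>R x"
            by (simp add: algebra_simps eq_neg_iff_add_eq_0)
          then show ?thesis
            using less.prems(2) by blast
        qed
      next
        case False
        then show ?thesis
          using less.hyps \<open>degree q < degree p\<close> \<open>q \<noteq> 0\<close> kernel by blast
      qed
    qed
  qed
  obtain x :: 'a where "x \<noteq> 0"
    using nonzero_Basis nonempty_Basis by blast
  then show ?thesis
    using descent vector_annihilated_by_operator_poly[OF lin] by blast
qed

section \<open>The algebra of intertwiners\<close>

definition intertwiners :: "(real^'n^'n) set \<Rightarrow> (real^'n \<Rightarrow> real^'n) set"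
  where "intertwiners G = {f. linear f \<and> (\<forall>g\<in>G. \<forall>x. f (g *v x) = g *v f x)}"

lemma intertwiner_linear: "f \<in> intertwiners G \<Longrightarrow> linear f"
  by (simp add: intertwiners_def)

lemma intertwiners_id: "(\<lambda>x. x) \<in> intertwiners G"
  by (simp add: intertwiners_def linear_iff)

lemma intertwiners_compose:
  "f \<in> intertwiners G \<Longrightarrow> h \<in> intertwiners G \<Longrightarrow> (\<lambda>x. f (h x)) \<in> intertwiners G"
  by (auto simp: intertwiners_def linear_iff)

lemma intertwiners_add:
  "f \<in> intertwiners G \<Longrightarrow> h \<in> intertwiners G \<Longrightarrow> (\<lambda>x. f x + h x) \<in> intertwiners G"
  by (auto simp: intertwiners_def linear_iff algebra_simps matrix_vector_right_distrib)

lemma intertwiners_scale: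
  "f \<in> intertwiners G \<Longrightarrow> (\<lambda>x. c *\<^sub>R f x) \<in> intertwiners G"
  by (auto simp: intertwiners_def linear_iff algebra_simps matrix_vector_mult_scaleR)

lemma intertwiners_diff:
  "f \<in> intertwiners G \<Longrightarrow> h \<in> intertwiners G \<Longrightarrow> (\<lambda>x. f x - h x) \<in> intertwiners G"
  using intertwiners_add[of f G "\<lambda>x. (-1) *\<^sub>R h x"] intertwiners_scale[of h G "-1"] by simp

text \<open>The kernel of an intertwiner is an invariant subspace.\<close>

lemma schur:
  assumes "acts_irreducibly G" "f \<in> intertwiners G" "f x = 0" "x \<noteq> 0"
  shows "f y = 0"
proof -
  let ?K = "{x. f x = 0}"
  have "linear f"
    by (rule intertwiner_linear[OF assms(2)])
  then have "subspace ?K"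
    by (rule linear_subspace_kernel)
  moreover have "\<forall>g\<in>G. \<forall>x\<in>?K. g *v x \<in> ?K"
    using assms(2) by (simp add: intertwiners_def)
  ultimately have "?K = {0} \<or> ?K = UNIV"
    using assms(1) by (simp add: acts_irreducibly_def)
  then show ?thesis
    using assms(3,4) by blast
qed

text \<open>
  By Schur's lemma a quadratic polynomial in \<open>f\<close> that kills one nonzero vector vanishes, and
  completing the square turns \<open>f - a\<close> into a multiple of a complex structure.
\<close>

lemma intertwiner_scalar_or_complex_structure:
  fixes f :: "real^'n \<Rightarrow> real^'n"
  assumes irr: "acts_irreducibly G" and f: "f \<in> intertwiners G"
  obtains (scalar) a where "\<And>x. f x = a *\<^sub>R x"
  | (complex_structure) a c J where "c \<noteq> 0" "J \<in> intertwiners G" "\<And>x. J (J x) = - x"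
      "\<And>x. f x = a *\<^sub>R x + c *\<^sub>R J x" "\<And>x. J x = (1 / c) *\<^sub>R (f x - a *\<^sub>R x)"
proof -
  note lin = intertwiner_linear[OF f]
  obtain a c x0 where x0: "x0 \<noteq> 0" "f (f x0) = (2 * a) *\<^sub>R f x0 - (a\<^sup>2 + c\<^sup>2) *\<^sub>R x0"
    using operator_annihilated_by_quadratic[OF lin] by blast
  have "(\<lambda>x. f (f x) - ((2 * a) *\<^sub>R f x - (a\<^sup>2 + c\<^sup>2) *\<^sub>R x)) \<in> intertwiners G"
    by (intro intertwiners_diff intertwiners_scale intertwiners_id f
        intertwiners_compose[OF f f])
  from schur[OF irr this _ x0(1)] x0(2)
  have quad: "f (f x) = (2 * a) *\<^sub>R f x - (a\<^sup>2 + c\<^sup>2) *\<^sub>R x" for x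
    by simp
  define N where "N = (\<lambda>x. f x - a *\<^sub>R x)"
  have N: "N \<in> intertwiners G"
    unfolding N_def by (intro intertwiners_diff intertwiners_scale intertwiners_id f)
  have twice: "(2 * a) *\<^sub>R v = a *\<^sub>R v + a *\<^sub>R v" for v :: "real^'n"
    by (simp flip: scaleR_left_distrib)
  have NN: "N (N x) = - (c\<^sup>2 *\<^sub>R x)" for x
    by (simp add: N_def linear_diff[OF lin] linear_scale[OF lin] quad twice
        scaleR_left_distrib scaleR_right_diff_distrib power2_eq_square)
  show thesis
  proof (cases "c = 0")
    case True
    have "N x = 0" for x
      using schur[OF irr N, of "N x" x] NN[of x] True by auto
    then show ?thesis
      using scalar[of a] by (simp add: N_def)
  next
    case False
    define J where "J = (\<lambda>x. (1 / c) *\<^sub>R N x)"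
    show ?thesis
    proof (rule complex_structure[OF False])
      show "J \<in> intertwiners G"
        unfolding J_def by (rule intertwiners_scale[OF N])
      show "J (J x) = - x" for x
        using False
        by (simp add: J_def linear_scale[OF intertwiner_linear[OF N]] NN power2_eq_square)
      show "f x = a *\<^sub>R x + c *\<^sub>R J x" for x
        using False by (simp add: J_def N_def)
      show "J x = (1 / c) *\<^sub>R (f x - a *\<^sub>R x)" for x
        by (simp add: J_def N_def)
    qed
  qed
qed

text \<open>
  A second complex structure \<open>L\<close> commuting with \<open>J\<close> satisfies \<open>(L - J) (L + J) = L\<^sup>2 - J\<^sup>2 = 0\<close>,
  so \<open>L = J\<close> or \<open>L = - J\<close>.
\<close>

lemma intertwiner_commuting_with_complex_structure:
  assumes irr: "acts_irreducibly G"
    and J: "J \<in> intertwiners G" "\<And>x. J (J x) = - x"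
    and h: "h \<in> intertwiners G" "\<And>x. h (J x) = J (h x)"
  obtains a c where "\<And>x. h x = a *\<^sub>R x + c *\<^sub>R J x"
  using irr h(1)
proof (cases rule: intertwiner_scalar_or_complex_structure)
  case (scalar a)
  then show ?thesis
    using that[of a 0] by simp
next
  case (complex_structure a c L)
  note linJ = intertwiner_linear[OF J(1)] and linL = intertwiner_linear[OF complex_structure(2)]
  have comm: "L (J x) = J (L x)" for x
    by (simp add: complex_structure(5) h(2) linear_diff[OF linJ] linear_scale[OF linJ])
  have diff: "(\<lambda>x. L x - J x) \<in> intertwiners G"
    by (intro intertwiners_diff complex_structure(2) J(1))
  have product: "L (L x + J x) - J (L x + J x) = 0" for x
    by (simp add: linear_add[OF linJ] linear_add[OF linL] comm J(2) complex_structure(3))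
  show ?thesis
  proof (cases "\<forall>x. L x + J x = 0")
    case True
    then have "L x = - J x" for x
      by (simp add: eq_neg_iff_add_eq_0)
    then show ?thesis
      using that[of a "-c"] by (simp add: complex_structure(4))
  next
    case False
    then have "L x = J x" for x
      using schur[OF irr diff, of _ x] product by auto
    then show ?thesis
      using that[of a c] by (simp add: complex_structure(4))
  qed
qed

section \<open>Self-adjoint intertwiners\<close>

definition selfadjoint_for :: "('a \<Rightarrow> 'a \<Rightarrow> real) \<Rightarrow> ('a \<Rightarrow> 'a) \<Rightarrow> bool"
  where "selfadjoint_for b f \<longleftrightarrow> (\<forall>x y. b (f x) y = b x (f y))"

lemma selfadjoint_for_affine:
  assumes "bilinear b" "selfadjoint_for b f" "\<And>x. J x = c *\<^sub>R (f x - a *\<^sub>R x)"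
  shows "selfadjoint_for b J"
  using assms(2) by (simp add: selfadjoint_for_def assms(3) bilinear_lmul[OF assms(1)]
      bilinear_rmul[OF assms(1)] bilinear_lsub[OF assms(1)] bilinear_rsub[OF assms(1)])

lemma nondegenerate_form_cancel:
  assumes "bilinear b" "nondegenerate_form b" "\<And>y. b u y = b v y"
  shows "u = v"
proof -
  have "b (u - v) y = 0" for y
    using assms(3)[of y] by (simp add: bilinear_lsub[OF assms(1)])
  then have "u - v = 0"
    using assms(2) unfolding nondegenerate_form_def by blast
  then show ?thesis
    by simp
qed

text \<open>
  If \<open>h\<close> is \<open>f\<close> or \<open>K\<close>, then the product \<open>h K\<close> commutes with \<open>J\<close>, so \<open>h K = a + c J\<close>. This is
  self-adjoint and therefore also equals the adjoint \<open>K h\<close> of \<open>h K\<close>. Now \<open>K (h K) = (K h) K\<close> says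
  that \<open>K\<close> commutes with \<open>a + c J\<close>, although it anticommutes with \<open>J\<close>; hence \<open>c = 0\<close>. Thus \<open>f K\<close>
  and \<open>K\<^sup>2\<close> are scalars, the latter nonzero, and \<open>f K\<^sup>2\<close> exhibits \<open>f\<close> as a multiple of \<open>K\<close>.
\<close>

lemma anticommuting_selfadjoint_proportional:
  assumes irr: "acts_irreducibly G" and b: "bilinear b" "nondegenerate_form b"
    and J: "J \<in> intertwiners G" "selfadjoint_for b J" "\<And>x. J (J x) = - x"
    and K: "K \<in> intertwiners G" "selfadjoint_for b K" "\<And>x. K (J x) = - J (K x)" "K x0 \<noteq> 0"
    and f: "f \<in> intertwiners G" "selfadjoint_for b f" "\<And>x. f (J x) = - J (f x)"
  shows "\<exists>d. \<forall>x. f x = d *\<^sub>R K x"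
proof -
  note linJ = intertwiner_linear[OF J(1)] and linK = intertwiner_linear[OF K(1)]
  have scalar: "\<exists>a. \<forall>x. h (K x) = a *\<^sub>R x"
    if h: "h \<in> intertwiners G" "selfadjoint_for b h" "\<And>x. h (J x) = - J (h x)" for h
  proof -
    note linh = intertwiner_linear[OF h(1)]
    have "h (K (J x)) = J (h (K x))" for x
      by (simp add: K(3) h(3) linear_neg[OF linh])
    from intertwiner_commuting_with_complex_structure
        [OF irr J(1,3) intertwiners_compose[OF h(1) K(1)] this]
    obtain a c where hK: "h (K x) = a *\<^sub>R x + c *\<^sub>R J x" for x
      by metis
    have Kh: "K (h x) = a *\<^sub>R x + c *\<^sub>R J x" for x
    proof (rule nondegenerate_form_cancel[OF b])
      fix y
      have "b (K (h x)) y = b x (h (K y))"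
        using K(2) h(2) by (simp add: selfadjoint_for_def)
      also have "\<dots> = a * b x y + c * b x (J y)"
        by (simp add: hK bilinear_radd[OF b(1)] bilinear_rmul[OF b(1)])
      also have "\<dots> = b (a *\<^sub>R x + c *\<^sub>R J x) y"
        using J(2)
        by (simp add: selfadjoint_for_def bilinear_ladd[OF b(1)] bilinear_lmul[OF b(1)])
      finally show "b (K (h x)) y = b (a *\<^sub>R x + c *\<^sub>R J x) y" .
    qed
    \<comment> \<open>Compare the two evaluations of \<open>K h K\<close>.\<close>
    have "c *\<^sub>R J (K x0) = - (c *\<^sub>R J (K x0))"
      using Kh[of "K x0"]
      by (simp add: hK linear_add[OF linK] linear_scale[OF linK] K(3))
    then have "c *\<^sub>R J (K x0) = 0"
      by (simp add: eq_neg_iff_add_eq_0 flip: scaleR_2)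
    moreover have "J (K x0) \<noteq> 0"
      using J(3)[of "K x0"] K(4) linear_0[OF linJ] by auto
    ultimately have "c = 0"
      by simp
    then show ?thesis
      using hK by auto
  qed
  obtain a where a: "f (K x) = a *\<^sub>R x" for x
    using scalar[OF f] by blast
  obtain k where k: "K (K x) = k *\<^sub>R x" for x
    using scalar[OF K(1-3)] by blast
  have "k \<noteq> 0"
    using schur[OF irr K(1), of "K x0" x0] K(4) k[of x0] by auto
  have "k *\<^sub>R f x = a *\<^sub>R K x" for x
    using a[of "K x"] by (simp add: k linear_scale[OF intertwiner_linear[OF f(1)]])
  then have "(1 / k) *\<^sub>R k *\<^sub>R f x = (1 / k) *\<^sub>R a *\<^sub>R K x" for x
    by simp
  then have "f x = (a / k) *\<^sub>R K x" for x
    using \<open>k \<noteq> 0\<close> by simp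
  then show ?thesis
    by blast
qed

text \<open>
  The case in which every self-adjoint intertwiner is scalar is trivial. Otherwise \<open>J\<close> is a
  self-adjoint complex structure and \<open>K\<close> a generator of the self-adjoint operators that
  anticommute with \<open>J\<close>.
\<close>

lemma selfadjoint_intertwiners_span:
  fixes b :: "real^'n \<Rightarrow> real^'n \<Rightarrow> real"
  assumes irr: "acts_irreducibly G" and b: "bilinear b" "nondegenerate_form b"
  shows "\<exists>J K. \<forall>f\<in>intertwiners G. selfadjoint_for b f \<longrightarrow>
    (\<exists>a c d. \<forall>x. f x = a *\<^sub>R x + c *\<^sub>R J x + d *\<^sub>R K x)"
proof (cases "\<forall>f\<in>intertwiners G. selfadjoint_for b f \<longrightarrow> (\<exists>a. \<forall>x. f x = a *\<^sub>R x)")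
  case True
  have "\<forall>f\<in>intertwiners G. selfadjoint_for b f \<longrightarrow>
    (\<exists>a c d. \<forall>x. f x = a *\<^sub>R x + c *\<^sub>R x + d *\<^sub>R x)"
  proof (intro ballI impI)
    fix f assume "f \<in> intertwiners G" "selfadjoint_for b f"
    then obtain a where "\<forall>x. f x = a *\<^sub>R x"
      using True by blast
    then show "\<exists>a c d. \<forall>x. f x = a *\<^sub>R x + c *\<^sub>R x + d *\<^sub>R x"
      by (intro exI[of _ a] exI[of _ 0]) simp
  qed
  then show ?thesis
    by (intro exI)
next
  case False
  then obtain f0 where f0: "f0 \<in> intertwiners G" "selfadjoint_for b f0"
    and nonscalar: "\<nexists>a. \<forall>x. f0 x = a *\<^sub>R x"
    by blast
  from irr f0(1) obtain J where J: "J \<in> intertwiners G" "selfadjoint_for b J" "\<And>x. J (J x) = - x"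
  proof (cases rule: intertwiner_scalar_or_complex_structure)
    case (scalar a)
    then show ?thesis
      using nonscalar by blast
  next
    case (complex_structure a c J)
    have "selfadjoint_for b J"
      by (rule selfadjoint_for_affine[OF b(1) f0(2) complex_structure(5)])
    then show ?thesis
      using that complex_structure by blast
  qed
  note linJ = intertwiner_linear[OF J(1)]
  let ?anti = "\<lambda>K. K \<in> intertwiners G \<and> selfadjoint_for b K \<and> (\<forall>x. K (J x) = - J (K x))"
  \<comment> \<open>The anticommuting part is a line or zero, so some \<open>K\<close> spans it.\<close>
  obtain K where K: "\<And>f. ?anti f \<Longrightarrow> \<exists>d. \<forall>x. f x = d *\<^sub>R K x"
  proof (cases "\<exists>K x0. ?anti K \<and> K x0 \<noteq> 0")
    case True
    then obtain K x0 where "?anti K" "K x0 \<noteq> 0"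
      by blast
    then show ?thesis
      using that[of K] anticommuting_selfadjoint_proportional[OF irr b J] by blast
  next
    case False
    then show ?thesis
      using that[of "\<lambda>_. 0"] by auto
  qed
  have "\<exists>a c d. \<forall>x. f x = a *\<^sub>R x + c *\<^sub>R J x + d *\<^sub>R K x"
    if f: "f \<in> intertwiners G" "selfadjoint_for b f" for f
  proof -
    note linf = intertwiner_linear[OF f(1)]
    \<comment> \<open>Averaging \<open>f\<close> over conjugation by \<open>J\<close>, whose inverse is \<open>- J\<close>, splits it into its
      commuting part \<open>p\<close> and its anticommuting part \<open>m\<close>.\<close>
    define p where "p = (\<lambda>x. (1 / 2) *\<^sub>R (f x - J (f (J x))))"
    define m where "m = (\<lambda>x. (1 / 2) *\<^sub>R (f x + J (f (J x))))"
    have conj: "(\<lambda>x. J (f (J x))) \<in> intertwiners G"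
      by (rule intertwiners_compose[OF J(1) intertwiners_compose[OF f(1) J(1)]])
    have "p \<in> intertwiners G"
      unfolding p_def by (rule intertwiners_scale[OF intertwiners_diff[OF f(1) conj]])
    have "m \<in> intertwiners G"
      unfolding m_def by (rule intertwiners_scale[OF intertwiners_add[OF f(1) conj]])
    have "p (J x) = J (p x)" for x
      by (simp add: p_def J(3) linear_scale[OF linJ] linear_diff[OF linJ] linear_neg[OF linf]
          linear_neg[OF linJ])
    from intertwiner_commuting_with_complex_structure
        [OF irr J(1,3) \<open>p \<in> intertwiners G\<close> this]
    obtain a c where p: "p x = a *\<^sub>R x + c *\<^sub>R J x" for x
      by metis
    have "m (J x) = - J (m x)" for x
      by (simp add: m_def J(3) linear_scale[OF linJ] linear_add[OF linJ] linear_neg[OF linf]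
          linear_neg[OF linJ] algebra_simps)
    moreover have "selfadjoint_for b m"
      using f(2) J(2) unfolding selfadjoint_for_def
      by (simp add: m_def bilinear_lmul[OF b(1)] bilinear_rmul[OF b(1)] bilinear_ladd[OF b(1)]
          bilinear_radd[OF b(1)])
    ultimately obtain d where m: "\<forall>x. m x = d *\<^sub>R K x"
      using K \<open>m \<in> intertwiners G\<close> by blast
    have "p x + m x = (1 / 2) *\<^sub>R (2 *\<^sub>R f x)" for x
      unfolding p_def m_def scaleR_right_distrib[symmetric] by (simp add: scaleR_2)
    then have "f x = p x + m x" for x
      by simp
    then show ?thesis
      using p m by auto
  qed
  then show ?thesis
    by blast
qed

section \<open>Signature\<close>

lemma finite_subspace_dims:
  "finite {dim U |U :: (real^'n) set. subspace U \<and> P U}"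
  by (rule finite_subset[of _ "{..CARD('n)}"]) (auto intro: order_trans[OF dim_subset_UNIV])

lemma dim_le_positive_index:
  fixes b :: "real^'n \<Rightarrow> real^'n \<Rightarrow> real"
  assumes "subspace U" "\<And>x. x \<in> U \<Longrightarrow> x \<noteq> 0 \<Longrightarrow> b x x > 0"
  shows "dim U \<le> positive_index b"
  unfolding positive_index_def
  by (rule Max_ge[OF finite_subspace_dims]) (use assms in blast)

lemma positive_index_attained:
  fixes b :: "real^'n \<Rightarrow> real^'n \<Rightarrow> real"
  obtains U where "subspace U" "\<And>x. x \<in> U \<Longrightarrow> x \<noteq> 0 \<Longrightarrow> b x x > 0" "dim U = positive_index b"
proof -
  let ?D = "{dim U |U. subspace U \<and> (\<forall>x\<in>U. x \<noteq> 0 \<longrightarrow> b x x > 0)}"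
  have "dim {0 :: real^'n} \<in> ?D"
    using subspace_single_0 by blast
  then have "positive_index b \<in> ?D"
    unfolding positive_index_def by (intro Max_in finite_subspace_dims) auto
  then show thesis
    using that by auto
qed

lemma negative_index_eq_positive_index_neg:
  "negative_index b = positive_index (\<lambda>x y. - b x y)"
  by (simp add: negative_index_def positive_index_def)

lemma bilinear_form_represented_by_operator:
  fixes b :: "'a::euclidean_space \<Rightarrow> 'a \<Rightarrow> real"
  assumes "bilinear b"
  obtains T where "linear T" "\<And>x y. b x y = T x \<bullet> y"
proof
  let ?T = "\<lambda>x. adjoint (b x) 1"
  show eq: "b x y = ?T x \<bullet> y" for x y
    using assms adjoint_works[of "b x" y 1] by (simp add: bilinear_def inner_commute)
  show "linear ?T"
    by (intro linearI; subst vector_eq_rdot[symmetric])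
      (simp_all add: inner_add_left bilinear_ladd[OF assms] bilinear_lmul[OF assms] flip: eq)
qed

lemma nondegenerate_operator_bij:
  fixes b :: "'a::euclidean_space \<Rightarrow> 'a \<Rightarrow> real"
  assumes "nondegenerate_form b" "linear T" "\<And>x y. b x y = T x \<bullet> y"
  shows "inj T" "surj T"
proof -
  show "inj T"
    using assms(1,3) by (simp add: linear_injective_0[OF assms(2)] nondegenerate_form_def)
  then show "surj T"
    using linear_injective_imp_surjective[OF assms(2)] by simp
qed

text \<open>
  The complement, orthogonal for \<open>b\<close>, of a maximal positive definite subspace is negative
  semidefinite by maximality, and then negative definite by the Cauchy-Schwarz argument and
  nondegeneracy. Its dimension is complementary.
\<close>

lemma positive_index_plus_negative_index:
  fixes b :: "real^'n \<Rightarrow> real^'n \<Rightarrow> real"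
  assumes b: "bilinear b" "symmetric_form b" "nondegenerate_form b"
  shows "positive_index b + negative_index b = CARD('n)"
proof (rule antisym)
  note bsimps = bilinear_ladd[OF b(1)] bilinear_radd[OF b(1)] bilinear_lmul[OF b(1)]
    bilinear_rmul[OF b(1)] bilinear_lzero[OF b(1)] bilinear_rzero[OF b(1)]
  have sym: "b x y = b y x" for x y
    using b(2) by (simp add: symmetric_form_def)
  obtain U where U: "subspace U" "\<And>x. x \<in> U \<Longrightarrow> x \<noteq> 0 \<Longrightarrow> b x x > 0" "dim U = positive_index b"
    using positive_index_attained[of b] by blast
  obtain N where N: "subspace N" "\<And>x. x \<in> N \<Longrightarrow> x \<noteq> 0 \<Longrightarrow> - b x x > 0" "dim N = negative_index b"
    unfolding negative_index_eq_positive_index_neg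
    using positive_index_attained[of "\<lambda>x y. - b x y"] by blast
  have "U \<inter> N = {0}"
    using U(1,2) N(1,2) by (force simp: subspace_0)
  then have "dim {x + y |x y. x \<in> U \<and> y \<in> N} = dim U + dim N"
    using dim_sums_Int[OF U(1) N(1)] by simp
  then show "positive_index b + negative_index b \<le> CARD('n)"
    using dim_subset_UNIV[of "{x + y |x y. x \<in> U \<and> y \<in> N}"] U(3) N(3) by simp
  define W where "W = {x. \<forall>u\<in>U. b x u = 0}"
  have W: "subspace W"
    by (simp add: W_def subspace_def bsimps)
  obtain T where T: "linear T" "\<And>x y. b x y = T x \<bullet> y"
    using bilinear_form_represented_by_operator[OF b(1)] by blast
  note bij = nondegenerate_operator_bij[OF b(3) T]
  have "T ` W = {y \<in> UNIV. \<forall>x\<in>U. orthogonal x y}"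
  proof (intro equalityI subsetI)
    fix y assume y: "y \<in> {y \<in> UNIV. \<forall>x\<in>U. orthogonal x y}"
    obtain x where "y = T x"
      using bij(2) by blast
    then show "y \<in> T ` W"
      using y by (auto simp: W_def T(2) orthogonal_def inner_commute)
  qed (auto simp: W_def T(2) orthogonal_def inner_commute)
  moreover have "dim (T ` W) = dim W"
    by (rule dim_image_eq[OF T(1)]) (rule inj_on_subset[OF bij(1)], simp)
  ultimately have dimW: "dim W + dim U = CARD('n)"
    using dim_subspace_orthogonal_to_vectors[OF U(1) subspace_UNIV] by simp
  have UW: "U \<inter> W = {0}"
  proof -
    have "x = 0" if "x \<in> U" "x \<in> W" for x
      using that U(2)[of x] by (auto simp: W_def)
    then show ?thesis
      using subspace_0[OF U(1)] subspace_0[OF W] by blast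
  qed
  have "dim {x + y |x y. x \<in> U \<and> y \<in> W} = CARD('n)"
    using dim_sums_Int[OF U(1) W] dimW UW by simp
  moreover have "subspace {x + y |x y. x \<in> U \<and> y \<in> W}"
    by (rule subspace_sums[OF U(1) W])
  ultimately have decomposition: "{x + y |x y. x \<in> U \<and> y \<in> W} = UNIV"
    using dim_eq_full[of "{x + y |x y. x \<in> U \<and> y \<in> W}"] by (simp add: span_eq_iff[THEN iffD2])
  have nonpos: "b w w \<le> 0" if w: "w \<in> W" for w
  proof (rule ccontr)
    assume "\<not> b w w \<le> 0"
    then have pos: "b w w > 0"
      by simp
    then have "w \<noteq> 0"
      using bilinear_lzero[OF b(1)] by auto
    then have "w \<notin> U"
      using UW w by blast
    have "b x x > 0" if x: "x \<in> span (insert w U)" "x \<noteq> 0" for x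
    proof -
      obtain k where k: "x - k *\<^sub>R w \<in> U"
        using x(1) U(1) by (auto simp: span_breakdown_eq span_eq_iff[THEN iffD2])
      define u where "u = x - k *\<^sub>R w"
      have "u \<in> U" "x = u + k *\<^sub>R w"
        using k by (simp_all add: u_def)
      have "b w u = 0" "b u w = 0"
        using w \<open>u \<in> U\<close> sym by (auto simp: W_def)
      then have eq: "b x x = b u u + k\<^sup>2 * b w w"
        by (simp add: \<open>x = u + k *\<^sub>R w\<close> bsimps power2_eq_square)
      show ?thesis
      proof (cases "u = 0")
        case True
        then have "k \<noteq> 0"
          using x(2) \<open>x = u + k *\<^sub>R w\<close> by auto
        then show ?thesis
          using True pos eq by (simp add: bsimps)
      next
        case False
        then have "b u u > 0"
          using U(2) \<open>u \<in> U\<close> by blast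
        then show ?thesis
          using pos eq by (simp add: add_pos_nonneg)
      qed
    qed
    then have "dim (span (insert w U)) \<le> positive_index b"
      by (intro dim_le_positive_index) auto
    then show False
      using U(1,3) \<open>w \<notin> U\<close> by (simp add: dim_insert span_eq_iff[THEN iffD2])
  qed
  have "b w w < 0" if w: "w \<in> W" "w \<noteq> 0" for w
  proof (rule ccontr)
    assume "\<not> b w w < 0"
    then have "b w w = 0"
      using nonpos[OF w(1)] by simp
    have isotropic: "b w v = 0" if v: "v \<in> W" for v
    proof (rule ccontr)
      assume ne: "b w v \<noteq> 0"
      \<comment> \<open>The value at \<open>v + t w\<close> is affine in \<open>t\<close>; this \<open>t\<close> makes it equal to one.\<close>
      define t where "t = (1 - b v v) / (2 * b w v)"
      have "v + t *\<^sub>R w \<in> W"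
        using v w(1) W by (simp add: subspace_add subspace_scale)
      moreover have "b (v + t *\<^sub>R w) (v + t *\<^sub>R w) = b v v + 2 * t * b w v"
        by (simp add: bsimps sym[of v w] \<open>b w w = 0\<close>)
      moreover have "\<dots> = 1"
        using ne by (simp add: t_def field_simps)
      ultimately show False
        using nonpos by fastforce
    qed
    have "b w y = 0" for y
    proof -
      obtain u v where "y = u + v" "u \<in> U" "v \<in> W"
        using decomposition by blast
      then show ?thesis
        using isotropic w(1) by (simp add: bsimps W_def)
    qed
    then show False
      using b(3) w(2) by (auto simp: nondegenerate_form_def)
  qed
  then have "dim W \<le> negative_index b"
    unfolding negative_index_eq_positive_index_neg by (intro dim_le_positive_index W) auto
  then show "CARD('n) \<le> positive_index b + negative_index b"
    using dimW U(3) by simp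
qed

lemma positive_index_le_of_isometry:
  fixes b b' :: "real^'n \<Rightarrow> real^'n \<Rightarrow> real"
  assumes "linear J" "inj J" "\<And>x. b' (J x) (J x) = b x x"
  shows "positive_index b \<le> positive_index b'"
proof -
  obtain U where U: "subspace U" "\<And>x. x \<in> U \<Longrightarrow> x \<noteq> 0 \<Longrightarrow> b x x > 0" "dim U = positive_index b"
    using positive_index_attained[of b] by blast
  have "dim (J ` U) \<le> positive_index b'"
    using U(2) assms(3) linear_0[OF assms(1)]
    by (intro dim_le_positive_index linear_subspace_image[OF assms(1) U(1)]) force
  moreover have "dim (J ` U) = dim U"
    by (rule dim_image_eq[OF assms(1)]) (rule inj_on_subset[OF assms(2)], simp)
  ultimately show ?thesis
    using U(3) by simp
qed

text \<open>
  As \<open>b (J x) (J x) = - b x x\<close>, the operator \<open>J\<close> is an isometry between \<open>b\<close> and \<open>- b\<close>.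
\<close>

lemma neutral_signature_if_selfadjoint_complex_structure:
  fixes b :: "real^'n \<Rightarrow> real^'n \<Rightarrow> real"
  assumes b: "bilinear b" "symmetric_form b" "nondegenerate_form b"
    and J: "linear J" "selfadjoint_for b J" "\<And>x. J (J x) = - x"
  shows "neutral_signature b"
proof -
  have "inj J"
    using J(3) by (metis injI neg_equal_iff_equal)
  have anti: "b (J x) (J x) = - b x x" for x
    using J(2) by (metis selfadjoint_for_def J(3) bilinear_rneg[OF b(1)])
  have "positive_index b = negative_index b"
    unfolding negative_index_eq_positive_index_neg
    by (intro antisym positive_index_le_of_isometry[OF J(1) \<open>inj J\<close>]) (simp_all add: anti)
  then show ?thesis
    using positive_index_plus_negative_index[OF b] b(3)
    by (auto simp: neutral_signature_def)
qed

section \<open>Invariant forms as self-adjoint intertwiners\<close>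

lemma invariant_symmetric_formD:
  assumes "b \<in> invariant_symmetric_forms G"
  shows "bilinear b" "symmetric_form b" "\<And>g x y. g \<in> G \<Longrightarrow> b (g *v x) (g *v y) = b x y"
  using assms by (auto simp: invariant_symmetric_forms_def invariant_form_def)

lemma invertible_matrix_vector_surj:
  fixes g :: "real^'n^'n"
  assumes "invertible g"
  obtains x where "y = g *v x"
  using assms by (metis invertible_def matrix_vector_mul_assoc matrix_vector_mul_lid)

text \<open>The radical of \<open>b\<close> is an invariant subspace, and it is proper as \<open>b \<noteq> 0\<close>.\<close>

lemma nonzero_invariant_form_nondegenerate:
  fixes G :: "(real^'n^'n) set"
  assumes inv: "\<And>g. g \<in> G \<Longrightarrow> invertible g" and irr: "acts_irreducibly G"
    and b: "b \<in> invariant_symmetric_forms G" and "b \<noteq> 0"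
  shows "nondegenerate_form b"
proof -
  note bil = invariant_symmetric_formD(1)[OF b]
  let ?R = "{x. \<forall>y. b x y = 0}"
  have "subspace ?R"
    by (simp add: subspace_def bilinear_ladd[OF bil] bilinear_lmul[OF bil] bilinear_lzero[OF bil])
  moreover have "\<forall>g\<in>G. \<forall>x\<in>?R. g *v x \<in> ?R"
  proof (intro ballI CollectI allI)
    fix g x y assume "g \<in> G" "x \<in> ?R"
    obtain z where "y = g *v z"
      using invertible_matrix_vector_surj[OF inv[OF \<open>g \<in> G\<close>]] by blast
    then show "b (g *v x) y = 0"
      using \<open>x \<in> ?R\<close> invariant_symmetric_formD(3)[OF b \<open>g \<in> G\<close>] by simp
  qed
  ultimately have "?R = {0} \<or> ?R = UNIV"
    using irr by (simp add: acts_irreducibly_def)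
  moreover have "?R \<noteq> UNIV"
    using \<open>b \<noteq> 0\<close> by (auto simp: fun_eq_iff)
  ultimately show ?thesis
    by (auto simp: nondegenerate_form_def)
qed

text \<open>
  The operator representing \<open>b'\<close> relative to \<open>b\<close> is unique. It commutes with \<open>G\<close> because both
  forms are invariant, and it is self-adjoint because both are symmetric.
\<close>

lemma form_represented_by_intertwiner:
  fixes G :: "(real^'n^'n) set"
  assumes inv: "\<And>g. g \<in> G \<Longrightarrow> invertible g"
    and b: "b \<in> invariant_symmetric_forms G" "nondegenerate_form b"
    and b': "b' \<in> invariant_symmetric_forms G"
  obtains f where "f \<in> intertwiners G" "selfadjoint_for b f" "\<And>x y. b' x y = b (f x) y"
proof -
  note bil = invariant_symmetric_formD(1)[OF b(1)]
  note sym = invariant_symmetric_formD(2)[OF b(1), unfolded symmetric_form_def]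
    and sym' = invariant_symmetric_formD(2)[OF b', unfolded symmetric_form_def]
  obtain T where T: "linear T" "\<And>x y. b x y = T x \<bullet> y"
    using bilinear_form_represented_by_operator[OF bil] by blast
  obtain T' where T': "linear T'" "\<And>x y. b' x y = T' x \<bullet> y"
    using bilinear_form_represented_by_operator[OF invariant_symmetric_formD(1)[OF b']] by blast
  note bij = nondegenerate_operator_bij[OF b(2) T]
  define f where "f = (\<lambda>x. inv_into UNIV T (T' x))"
  have f: "b' x y = b (f x) y" for x y
    by (simp add: f_def T(2) T'(2) surj_f_inv_f[OF bij(2)])
  have "linear (inv_into UNIV T)"
    by (rule inj_linear_imp_inv_linear[OF T(1) bij(1)])
  then have "linear f"
    using linear_compose[OF T'(1)] by (simp add: f_def o_def)
  moreover have "f (g *v x) = g *v f x" if g: "g \<in> G" for g x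
  proof (rule nondegenerate_form_cancel[OF bil b(2)])
    fix y
    obtain z where z: "y = g *v z"
      using invertible_matrix_vector_surj[OF inv[OF g]] by blast
    show "b (f (g *v x)) y = b (g *v f x) y"
      using invariant_symmetric_formD(3)[OF b(1) g] invariant_symmetric_formD(3)[OF b' g]
      by (simp add: z flip: f)
  qed
  moreover have "selfadjoint_for b f"
    unfolding selfadjoint_for_def using f sym sym' by metis
  ultimately show thesis
    using that[OF _ _ f] by (simp add: intertwiners_def)
qed

lemma invariant_forms_proportional_if_not_neutral:
  fixes G :: "(real^'n^'n) set"
  assumes inv: "\<And>g. g \<in> G \<Longrightarrow> invertible g" and irr: "acts_irreducibly G"
    and b: "b \<in> invariant_symmetric_forms G" "b \<noteq> 0" "\<not> neutral_signature b"
    and b': "b' \<in> invariant_symmetric_forms G"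
  shows "\<exists>a. b' = scale_form a b"
proof -
  note bil = invariant_symmetric_formD(1)[OF b(1)]
  note nondeg = nonzero_invariant_form_nondegenerate[OF inv irr b(1,2)]
  obtain f where f: "f \<in> intertwiners G" "selfadjoint_for b f" "\<And>x y. b' x y = b (f x) y"
    using form_represented_by_intertwiner[OF inv b(1) nondeg b'] by blast
  from irr f(1) show ?thesis
  proof (cases rule: intertwiner_scalar_or_complex_structure)
    case (scalar a)
    then show ?thesis
      by (auto simp: scale_form_def fun_eq_iff f(3) bilinear_lmul[OF bil])
  next
    case (complex_structure a c J)
    have "selfadjoint_for b J"
      by (rule selfadjoint_for_affine[OF bil f(2) complex_structure(5)])
    then have "neutral_signature b"
      using neutral_signature_if_selfadjoint_complex_structure[OF bil
          invariant_symmetric_formD(2)[OF b(1)] nondeg intertwiner_linear[OF complex_structure(2)]]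
        complex_structure(3) by blast
    then show ?thesis
      using b(3) by blast
  qed
qed

lemma invariant_symmetric_forms_spanned_by_three:
  fixes G :: "(real^'n^'n) set"
  assumes inv: "\<And>g. g \<in> G \<Longrightarrow> invertible g" and irr: "acts_irreducibly G"
  obtains T where "finite T" "card T \<le> 3" "invariant_symmetric_forms G \<subseteq> form.span T"
proof (cases "invariant_symmetric_forms G \<subseteq> {0}")
  case True
  then show ?thesis
    using that[of "{}"] by simp
next
  case False
  then obtain b where b: "b \<in> invariant_symmetric_forms G" "b \<noteq> 0"
    by blast
  note bil = invariant_symmetric_formD(1)[OF b(1)]
  note nondeg = nonzero_invariant_form_nondegenerate[OF inv irr b]
  obtain J K where JK: "\<And>f. f \<in> intertwiners G \<Longrightarrow> selfadjoint_for b f \<Longrightarrow>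
      \<exists>a c d. \<forall>x. f x = a *\<^sub>R x + c *\<^sub>R J x + d *\<^sub>R K x"
    using selfadjoint_intertwiners_span[OF irr bil nondeg] by blast
  let ?T = "{b, \<lambda>x y. b (J x) y, \<lambda>x y. b (K x) y}"
  have "b' \<in> form.span ?T" if b': "b' \<in> invariant_symmetric_forms G" for b'
  proof -
    obtain f where f: "f \<in> intertwiners G" "selfadjoint_for b f" "\<And>x y. b' x y = b (f x) y"
      using form_represented_by_intertwiner[OF inv b(1) nondeg b'] by blast
    obtain a c d where "\<forall>x. f x = a *\<^sub>R x + c *\<^sub>R J x + d *\<^sub>R K x"
      using JK[OF f(1,2)] by blast
    then have "b' = scale_form a b + scale_form c (\<lambda>x y. b (J x) y) + scale_form d (\<lambda>x y. b (K x) y)"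
      by (simp add: fun_eq_iff scale_form_def f(3) bilinear_ladd[OF bil] bilinear_lmul[OF bil])
    also have "\<dots> \<in> form.span ?T"
      by (intro form.span_add form.span_scale form.span_base) auto
    finally show ?thesis .
  qed
  moreover have "card ?T \<le> 3"
    by (intro card_insert_le_m1) simp_all
  ultimately show ?thesis
    using that[of ?T] by auto
qed

theorem theorem3:
  fixes G :: "(real^'n^'n) set"
  assumes "subgroup G GL"
    and "acts_irreducibly G"
  shows "(\<forall>b\<^sub>1 \<in> invariant_symmetric_forms G. \<forall>b\<^sub>2 \<in> invariant_symmetric_forms G.
            \<not> neutral_signature b\<^sub>1 \<longrightarrow> \<not> neutral_signature b\<^sub>2 \<longrightarrow>
            (\<exists>c\<^sub>1 c\<^sub>2. (c\<^sub>1 \<noteq> 0 \<or> c\<^sub>2 \<noteq> 0) \<and> scale_form c\<^sub>1 b\<^sub>1 + scale_form c\<^sub>2 b\<^sub>2 = 0))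
       \<and> (\<exists>B. finite B \<and> card B \<le> 3 \<and> form.independent B \<and>
            form.span B = invariant_symmetric_forms G)"
proof (intro conjI ballI impI)
  have inv: "invertible g" if "g \<in> G" for g
    using subgroup.subset[OF assms(1)] that by (auto simp: GL_def)
  {
    fix b\<^sub>1 b\<^sub>2
    assume b: "b\<^sub>1 \<in> invariant_symmetric_forms G" "b\<^sub>2 \<in> invariant_symmetric_forms G"
      "\<not> neutral_signature b\<^sub>1"
    show "\<exists>c\<^sub>1 c\<^sub>2. (c\<^sub>1 \<noteq> 0 \<or> c\<^sub>2 \<noteq> 0) \<and> scale_form c\<^sub>1 b\<^sub>1 + scale_form c\<^sub>2 b\<^sub>2 = 0"
    proof (cases "b\<^sub>1 = 0")
      case True
      then show ?thesis
        by (intro exI[of _ 1] exI[of _ 0]) simp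
    next
      case False
      then obtain a where "b\<^sub>2 = scale_form a b\<^sub>1"
        using invariant_forms_proportional_if_not_neutral[OF inv assms(2) b(1) _ b(3,2)] by blast
      then show ?thesis
        by (intro exI[of _ a] exI[of _ "-1"]) simp
    qed
  }
  obtain T where T: "finite T" "card T \<le> 3" "invariant_symmetric_forms G \<subseteq> form.span T"
    using invariant_symmetric_forms_spanned_by_three[OF inv assms(2)] by blast
  obtain B where B: "B \<subseteq> invariant_symmetric_forms G" "form.independent B"
    "invariant_symmetric_forms G \<subseteq> form.span B"
    using form.maximal_independent_subset by blast
  have "finite B \<and> card B \<le> card T"
    using form.independent_span_bound[OF T(1) B(2)] B(1) T(3) by blast
  moreover have "form.span B = invariant_symmetric_forms G"
    by (intro antisym form.span_minimal B subspace_invariant_symmetric_forms)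
  ultimately show "\<exists>B. finite B \<and> card B \<le> 3 \<and> form.independent B \<and>
      form.span B = invariant_symmetric_forms G"
    using B(2) T(2) by (intro exI[of _ B]) auto
qed

end
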